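(* Let $k$ and $s$ be constants and $c=\Theta(n^{-\alpha})$ for some $\alpha\in(0,1)$. Let $\tau$ be the largest integer satisfying $\alpha\binom{\tau}{s-1}<1$ and suppose that $$T\ge\begin{cases} 2n^{\tau+1}c^{\binom{\tau+1}{s}}(3\log n)^{(k-\tau)(1+\epsilon)} & \text{if } k\ge\tau+1,\\ 2n^k c^{\binom{k}{s}}(\log n)^{1+\epsilon} & \text{if } k<\tau+1,\end{cases}$$ for some $\epsilon>0$. Then GREEDY-RANDOM-SAMPLING run with $T$ iterations terminates with $S=\mathrm{cl}_k(G)$ with probability $1-n^{-\omega(1)}$ over the random bits of the algorithm GREEDY-RANDOM-SAMPLING and over the choice of random hypergraph $G\sim G(n,c,s)$.
   Context: Here $2\le s\le k$ are integers. $G(n,c,s)$ is the Erdős–Rényi distribution on $s$-uniform hypergraphs with vertex set $[n]$, in which each of the $\binom{n}{s}$ possible hyperedges is included independently with probability $c$. A $k$-clique of $G$ is a $k$-subset $W$ of vertices with $\binom{W}{s}\subseteq E(G)$; $\mathrm{cl}_k(G)$ is the set of $k$-cliques of $G$. For $A\subseteq[n]$, let $$\mathrm{CN}_G(A)=\{v\in V(G)\setminus A: B\cup\{v\}\in E(G)\text{ for all }(s-1)\text{-subsets }B\subseteq A\}.$$ The algorithm GREEDY-RANDOM-SAMPLING, on input an $s$-uniform hypergraph $G$ on $[n]$, maintains a set $S$ (initially empty) of $k$-subsets of $[n]$ and, for $T$ independent iterations, does the following. (1) Sample distinct starting vertices $v_1,\dots,v_{s-1}$ uniformly at random, and then sample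 $v_s,v_{s+1},\dots,v_k$ iteratively, where $v_{i+1}$ is chosen uniformly at random from $\mathrm{CN}_G(\{v_1,\dots,v_i\})$ if this set is nonempty (otherwise the iteration ends without choosing $k$ vertices). (2) If $k$ vertices $v_1,\dots,v_k$ are chosen, add $\{v_1,\dots,v_k\}$ to $S$ if it is not already in $S$. The notation $n^{-\omega(1)}$ denotes a quantity decaying faster than any fixed polynomial in $1/n$. *)

theory Defs
  imports
    "HOL-Probability.Probability"
    "HOL-Library.Landau_Symbols"
    "HOL-Library.Monad_Syntax"
    "HOL-Library.Ramsey"
begin

text \<open>
  A hypergraph on the vertex set \<open>{1..n}\<close> is represented by its set of hyperedges, an element of
  \<open>Pow (nsets {1..n} s)\<close> in the \<open>s\<close>-uniform case; the vertex set is passed along as \<open>n\<close>.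
\<close>

type_synonym hgraph = "nat set set"

definition random_hgraph :: "nat \<Rightarrow> real \<Rightarrow> nat \<Rightarrow> hgraph pmf" where
  "random_hgraph n c s =
     map_pmf (\<lambda>f. {e \<in> nsets {1..n} s. f e})
       (Pi_pmf (nsets {1..n} s) False (\<lambda>_. bernoulli_pmf c))"

definition cliques :: "nat \<Rightarrow> nat \<Rightarrow> nat \<Rightarrow> hgraph \<Rightarrow> nat set set" where
  "cliques n k s E = {W \<in> nsets {1..n} k. nsets W s \<subseteq> E}"

definition common_nbrs :: "nat \<Rightarrow> nat \<Rightarrow> hgraph \<Rightarrow> nat set \<Rightarrow> nat set" where
  "common_nbrs n s E A = {v \<in> {1..n} - A. \<forall>B \<in> nsets A (s - 1). B \<union> {v} \<in> E}"

text \<open>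
  \<open>grs_extend n s E m vs\<close> appends \<open>m\<close> further vertices to the vertices \<open>vs\<close> chosen so far;
  \<open>None\<close> means that the iteration ended prematurely.
\<close>

primrec grs_extend :: "nat \<Rightarrow> nat \<Rightarrow> hgraph \<Rightarrow> nat \<Rightarrow> nat list \<Rightarrow> nat list option pmf" where
  "grs_extend n s E 0 vs = return_pmf (Some vs)"
| "grs_extend n s E (Suc m) vs =
     (let C = common_nbrs n s E (set vs) in
      if C = {} then return_pmf None
      else do { v \<leftarrow> pmf_of_set C; grs_extend n s E m (vs @ [v]) })"

text \<open>
  The starting tuple is uniform on the ordered \<open>(s - 1)\<close>-tuples of distinct vertices. This is
  meaningful only if such a tuple exists, i.e. \<open>s - 1 \<le> n\<close>; for smaller \<open>n\<close> the value of
  \<open>pmf_of_set\<close> is unspecified.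
\<close>

definition grs_iteration :: "nat \<Rightarrow> nat \<Rightarrow> nat \<Rightarrow> hgraph \<Rightarrow> nat list option pmf" where
  "grs_iteration n k s E = do {
     vs \<leftarrow> pmf_of_set {vs. length vs = s - 1 \<and> distinct vs \<and> set vs \<subseteq> {1..n}};
     grs_extend n s E (k - (s - 1)) vs }"

text \<open>The distribution of the set \<open>S\<close> after a given number of iterations.\<close>

primrec greedy_random_sampling ::
    "nat \<Rightarrow> nat \<Rightarrow> nat \<Rightarrow> hgraph \<Rightarrow> nat \<Rightarrow> nat set set pmf" where
  "greedy_random_sampling n k s E 0 = return_pmf {}"
| "greedy_random_sampling n k s E (Suc t) = do {
     S \<leftarrow> greedy_random_sampling n k s E t;
     r \<leftarrow> grs_iteration n k s E;
     return_pmf (case r of None \<Rightarrow> S | Some vs \<Rightarrow> insert (set vs) S) }"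

text \<open>The joint distribution of the random hypergraph and the output of the algorithm on it.\<close>

definition grs_experiment ::
    "nat \<Rightarrow> real \<Rightarrow> nat \<Rightarrow> nat \<Rightarrow> nat \<Rightarrow> (hgraph \<times> nat set set) pmf" where
  "grs_experiment n c s k T = do {
     E \<leftarrow> random_hgraph n c s;
     S \<leftarrow> greedy_random_sampling n k s E T;
     return_pmf (E, S) }"

text \<open>
  \<open>superpoly_small f\<close> renders \<open>f n = n\<close> to the power \<open>-\<omega>(1)\<close>, read as decay faster than every fixed
  power of \<open>1 / n\<close>, so that \<open>f n = 0\<close> is included.
\<close>

definition superpoly_small :: "(nat \<Rightarrow> real) \<Rightarrow> bool" where
  "superpoly_small f \<longleftrightarrow> (\<forall>d::nat. f \<in> o(\<lambda>n. (1 / real n) ^ d))"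

end

theory Submission
  imports Defs "HOL-Real_Asymp.Real_Asymp"
begin

text \<open>
  For an \<open>i\<close>-set \<open>A\<close> the size of \<open>CN(A)\<close> is binomial with mean at most \<open>n c^(i choose (s - 1))\<close>, so with
  probability superpolynomially close to 1 all these sets satisfy \<open>|CN(A)| < b i\<close>, where \<open>b i\<close> is a
  constant multiple of the mean for \<open>i \<le> \<tau>\<close> (the mean is then a positive power of \<open>n\<close>) and \<open>3 ln n\<close> for
  \<open>i > \<tau>\<close> (the mean is then bounded). In that event one iteration finds a given clique, already along
  one fixed ordering of its vertices, with probability at least
  \<open>q = 1 / (n^(s - 1) \<Prod>i. b i)\<close>. The exponents of \<open>c\<close> add up to a binomial coefficient, and the
  hypothesis on \<open>T\<close> says that \<open>q T\<close> is at least a constant times \<open>(ln n)^(1 + \<epsilon>)\<close>; a union bound over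
  the at most \<open>n^k\<close> cliques finishes the proof.
\<close>

lemma prob_bind_pmf:
  "measure_pmf.prob (bind_pmf p f) X = measure_pmf.expectation p (\<lambda>x. measure_pmf.prob (f x) X)"
  unfolding measure_pmf_bind
  by (rule measure_pmf.measure_bind[where N = "count_space UNIV"]) (simp_all add: measure_pmf_in_subprob_algebra)

section \<open>Common neighbourhoods in the random hypergraph\<close>

lemma random_hgraph_superset_prob:
  assumes "0 \<le> c" "c \<le> 1" "F \<subseteq> nsets {1..n} s"
  shows "measure_pmf.prob (random_hgraph n c s) {E. F \<subseteq> E} = c ^ card F"
proof -
  let ?N = "nsets {1..n} s"
  have fin: "finite ?N" by (simp add: finite_imp_finite_nsets)
  have "measure_pmf.prob (random_hgraph n c s) {E. F \<subseteq> E} =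
    measure_pmf.prob (Pi_pmf ?N False (\<lambda>_. bernoulli_pmf c)) (Pi ?N (\<lambda>e. if e \<in> F then {True} else UNIV))"
    unfolding random_hgraph_def measure_map_pmf using assms(3)
    by (intro arg_cong2[where f = measure]) (auto simp: Pi_def vimage_def)
  also have "\<dots> = (\<Prod>e\<in>?N. measure_pmf.prob (bernoulli_pmf c) (if e \<in> F then {True} else UNIV))"
    using fin by (rule measure_Pi_pmf_Pi)
  also have "\<dots> = (\<Prod>e\<in>?N. if e \<in> F then c else 1)"
    using assms by (intro prod.cong) (auto simp: measure_pmf_single)
  also have "\<dots> = (\<Prod>e\<in>F. c)"
    using fin assms(3) by (intro prod.mono_neutral_cong_right) auto
  finally show ?thesis by simp
qed

lemma common_nbrs_subset: "common_nbrs n s E A \<subseteq> {1..n} - A"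
  by (auto simp: common_nbrs_def)

lemma finite_common_nbrs [simp]: "finite (common_nbrs n s E A)"
  by (rule finite_subset[OF common_nbrs_subset]) auto

text \<open>As \<open>M\<close> is disjoint from \<open>A\<close>, the edge
  \<open>insert v B\<close> determines \<open>v\<close> as its only vertex outside \<open>A\<close>,
  and then \<open>B\<close>. Hence the event prescribes \<open>card M * (i choose (s - 1))\<close>
  different edges, which are present independently.\<close>

lemma subset_common_nbrs_prob:
  assumes "0 \<le> c" "c \<le> 1" "s \<ge> 1" "A \<in> nsets {1..n} i" "M \<subseteq> {1..n} - A"
  shows "measure_pmf.prob (random_hgraph n c s) {E. M \<subseteq> common_nbrs n s E A}
           = (c ^ (i choose (s - 1))) ^ card M"
proof -
  let ?g = "\<lambda>(v, B). insert v B" and ?P = "M \<times> nsets A (s - 1)"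
  have A: "A \<subseteq> {1..n}" "finite A" "card A = i" using assms(4) by (auto simp: nsets_def)
  have "{E. M \<subseteq> common_nbrs n s E A} = {E. ?g ` ?P \<subseteq> E}"
    using assms(5) by (auto simp: common_nbrs_def subset_iff)
  moreover have "?g ` ?P \<subseteq> nsets {1..n} s"
  proof clarify
    fix v B assume *: "v \<in> M" "B \<in> nsets A (s - 1)"
    hence "v \<notin> B" "finite B" "card B = s - 1" "B \<subseteq> A" using assms(5) by (auto simp: nsets_def)
    thus "insert v B \<in> nsets {1..n} s"
      using * assms(3,5) A by (auto simp: nsets_def)
  qed
  moreover have "inj_on ?g ?P"
  proof (rule inj_onI, clarify)
    fix v B w C
    assume *: "v \<in> M" "B \<in> nsets A (s - 1)" "w \<in> M" "C \<in> nsets A (s - 1)" "insert v B = insert w C"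
    have "v \<notin> A" "w \<notin> A" "B \<subseteq> A" "C \<subseteq> A" using * assms(5) by (auto simp: nsets_def)
    moreover from this have "v = w" using *(5) by blast
    ultimately show "v = w \<and> B = C" using *(5) by (metis insert_ident subsetD)
  qed
  hence "card (?g ` ?P) = card M * (i choose (s - 1))"
    by (simp add: card_image card_cartesian_product A)
  ultimately show ?thesis
    using random_hgraph_superset_prob[OF assms(1,2), of "?g ` ?P" n s]
    by (simp flip: power_mult add: mult.commute)
qed

text \<open>The left side is a single term of the exponential series. With \<open>x = m\<close> this
  serves as a crude Stirling bound.\<close>

lemma power_div_fact_le_exp:
  assumes "(x::real) \<ge> 0"
  shows "x ^ m / fact m \<le> exp x"
proof -
  have "(\<Sum>i\<in>{m}. inverse (fact i) * x ^ i) \<le> (\<Sum>i. inverse (fact i) * x ^ i)"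
    using assms by (intro sum_le_suminf summable_exp) auto
  thus ?thesis by (simp add: exp_def divide_inverse mult.commute)
qed

text \<open>A union bound over all \<open>m\<close>-sets of candidate vertices gives
  \<open>(n * p) ^ m / fact m\<close>. Of the factor \<open>exp (D + 1)\<close> in the hypothesis,
  \<open>exp 1\<close> compensates \<open>m ^ m / fact m \<le> exp m\<close>, and
  \<open>exp D\<close> is left as the rate of decay.\<close>

lemma card_common_nbrs_tail:
  assumes "0 \<le> c" "c \<le> 1" "s \<ge> 1" "A \<in> nsets {1..n} i" "D \<ge> 0" "b > 0"
    and "exp (D + 1) * real n * c ^ (i choose (s - 1)) \<le> b"
  shows "measure_pmf.prob (random_hgraph n c s) {E. b \<le> real (card (common_nbrs n s E A))}
           \<le> exp (- D * b)"
proof -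
  \<comment> \<open>Cardinalities are integers, so exceeding the real threshold \<open>b\<close>
    already means containing a set of this size.\<close>
  define m where "m = nat \<lceil>b\<rceil>"
  define p where "p = c ^ (i choose (s - 1))"
  let ?P = "measure_pmf.prob (random_hgraph n c s)"
  have p: "p \<ge> 0" using assms by (simp add: p_def)
  have m: "m > 0" "b \<le> real m" using assms(6) by (auto simp: m_def)
  have "{E. b \<le> real (card (common_nbrs n s E A))}
      \<subseteq> (\<Union>M\<in>nsets ({1..n} - A) m. {E. M \<subseteq> common_nbrs n s E A})"
  proof clarify
    fix E assume "b \<le> real (card (common_nbrs n s E A))"
    hence "m \<le> card (common_nbrs n s E A)" unfolding m_def by linarith
    then obtain M where "M \<subseteq> common_nbrs n s E A" "card M = m" "finite M"
      by (meson obtain_subset_with_card_n)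
    thus "E \<in> (\<Union>M\<in>nsets ({1..n} - A) m. {E. M \<subseteq> common_nbrs n s E A})"
      using common_nbrs_subset[of n s E A] by (auto simp: nsets_def)
  qed
  hence "?P {E. b \<le> real (card (common_nbrs n s E A))}
      \<le> ?P (\<Union>M\<in>nsets ({1..n} - A) m. {E. M \<subseteq> common_nbrs n s E A})"
    by (intro measure_pmf.finite_measure_mono) auto
  also have "\<dots> \<le> (\<Sum>M\<in>nsets ({1..n} - A) m. ?P {E. M \<subseteq> common_nbrs n s E A})"
    by (intro measure_pmf.finite_measure_subadditive_finite finite_imp_finite_nsets) auto
  also have "\<dots> = (\<Sum>M\<in>nsets ({1..n} - A) m. p ^ m)"
    using assms by (intro sum.cong refl) (subst subset_common_nbrs_prob, auto simp: nsets_def p_def)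
  also have "\<dots> = real (card ({1..n} - A) choose m) * p ^ m" by simp
  also have "\<dots> \<le> real (n choose m) * p ^ m"
    using p card_mono[of "{1..n}" "{1..n} - A"]
    by (intro mult_right_mono) (auto intro!: binomial_right_mono)
  also have "\<dots> \<le> (real n * p) ^ m / fact m"
  proof -
    have "real (n choose m) * fact m \<le> real n ^ m"
      using binomial_fact_pow[of n m] by (metis of_nat_fact of_nat_le_iff of_nat_mult of_nat_power)
    hence "real (n choose m) * fact m * p ^ m \<le> real n ^ m * p ^ m"
      using p by (intro mult_right_mono) auto
    thus ?thesis by (simp add: field_simps)
  qed
  also have "\<dots> \<le> (exp (- D - 1) * real m) ^ m / fact m"
  proof -
    have "real n * p \<le> exp (- D - 1) * real m"
    proof -
      have "exp (D + 1) * (real n * p) \<le> real m" using assms(7) m by (simp add: p_def mult.assoc)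
      hence "exp (- D - 1) * (exp (D + 1) * (real n * p)) \<le> exp (- D - 1) * real m"
        by (intro mult_left_mono) auto
      moreover have "exp (- D - 1) * exp (D + 1) = 1" by (simp flip: exp_add)
      ultimately show ?thesis by (simp flip: mult.assoc)
    qed
    thus ?thesis using p by (intro divide_right_mono power_mono) auto
  qed
  also have "\<dots> = exp (- D - 1) ^ m * (real m ^ m / fact m)" by (simp add: power_mult_distrib)
  also have "\<dots> \<le> exp (- D - 1) ^ m * exp (real m)"
    by (intro mult_left_mono power_div_fact_le_exp) auto
  also have "\<dots> = exp (- D * real m)"
    by (simp add: algebra_simps flip: exp_of_nat_mult exp_add)
  also have "\<dots> \<le> exp (- D * b)" using assms(5) m by (simp add: mult_left_mono)
  finally show ?thesis .
qed

section \<open>Probability that one iteration finds a given clique\<close>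

text \<open>Only the run that draws \<open>us\<close> in this order is counted. Each next vertex is
  a common neighbour of the earlier ones because all edges inside the clique are present, so it is
  drawn with probability 1 over a cardinality that is at most \<open>b i\<close>.\<close>

lemma grs_extend_pmf_lower:
  assumes "s \<ge> 1" "distinct (vs @ us)" "length us = m"
    and "set (vs @ us) \<subseteq> {1..n}" "nsets (set (vs @ us)) s \<subseteq> E"
    and "\<And>i A. \<lbrakk>length vs \<le> i; i < length vs + m; A \<in> nsets {1..n} i\<rbrakk>
           \<Longrightarrow> real (card (common_nbrs n s E A)) \<le> b i"
  shows "(\<Prod>i\<in>{length vs..<length vs + m}. 1 / b i) \<le> pmf (grs_extend n s E m vs) (Some (vs @ us))"
  using assms(2-)
proof (induction m arbitrary: vs us)
  case 0
  then show ?case by simp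
next
  case (Suc m)
  then obtain u us' where us: "us = u # us'" by (cases us) auto
  let ?C = "common_nbrs n s E (set vs)"
  have u: "u \<in> ?C"
  proof -
    have "B \<union> {u} \<in> E" if B: "B \<in> nsets (set vs) (s - 1)" for B
    proof -
      have "u \<notin> B" "finite B" using B Suc.prems(1) us by (auto simp: nsets_def)
      hence "B \<union> {u} \<in> nsets (set (vs @ us)) s" using B assms(1) us by (auto simp: nsets_def)
      thus ?thesis using Suc.prems(4) by blast
    qed
    thus ?thesis using Suc.prems us by (auto simp: common_nbrs_def)
  qed
  hence card: "card ?C > 0" by (auto simp: card_gt_0_iff)
  have vs: "set vs \<in> nsets {1..n} (length vs)"
    using Suc.prems by (auto simp: nsets_def distinct_card)
  have b: "real (card ?C) \<le> b (length vs)" using Suc.prems(5)[OF _ _ vs] by simp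
  let ?R = "\<Prod>i\<in>{Suc (length vs)..<Suc (length vs) + m}. 1 / b i"
  have IH: "?R \<le> pmf (grs_extend n s E m (vs @ [u])) (Some (vs @ us))"
    using Suc.IH[of "vs @ [u]" us'] Suc.prems us by simp
  have "(\<Prod>i\<in>{length vs..<length vs + Suc m}. 1 / b i) = 1 / b (length vs) * ?R"
    by (subst prod.atLeast_Suc_lessThan) auto
  also have "\<dots> \<le> 1 / b (length vs) * pmf (grs_extend n s E m (vs @ [u])) (Some (vs @ us))"
    using b card by (intro mult_left_mono IH) auto
  also have "\<dots> \<le> 1 / real (card ?C) * pmf (grs_extend n s E m (vs @ [u])) (Some (vs @ us))"
    using b card by (intro mult_right_mono) (auto simp: frac_le)
  \<comment> \<open>All choices of the next vertex other than \<open>u\<close> contribute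
    nonnegative terms.\<close>
  also have "\<dots> \<le> (\<Sum>v\<in>?C. pmf (grs_extend n s E m (vs @ [v])) (Some (vs @ us))) / real (card ?C)"
    using u member_le_sum[of u ?C "\<lambda>v. pmf (grs_extend n s E m (vs @ [v])) (Some (vs @ us))"]
    by (simp add: divide_right_mono)
  also have "\<dots> = pmf (grs_extend n s E (Suc m) vs) (Some (vs @ us))"
    using u by (auto simp: Let_def pmf_bind_pmf_of_set)
  finally show ?case .
qed

lemma grs_iteration_pmf_lower:
  assumes "1 \<le> s" "s \<le> k" "W \<in> cliques n k s E"
    and b: "\<And>i A. \<lbrakk>s - 1 \<le> i; i < k; A \<in> nsets {1..n} i\<rbrakk>
           \<Longrightarrow> real (card (common_nbrs n s E A)) \<le> b i"
  obtains ws where "set ws = W"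
    "1 / (real n ^ (s - 1) * (\<Prod>i\<in>{s - 1..<k}. b i)) \<le> pmf (grs_iteration n k s E) (Some ws)"
proof -
  define ws where "ws = sorted_list_of_set W"
  have W: "W \<subseteq> {1..n}" "finite W" "card W = k" "nsets W s \<subseteq> E"
    using assms(3) by (auto simp: cliques_def nsets_def)
  have ws: "set ws = W" "distinct ws" "length ws = k" using W by (auto simp: ws_def)
  define vs us where "vs = take (s - 1) ws" and "us = drop (s - 1) ws"
  have vu: "vs @ us = ws" "length vs = s - 1" "length us = k - (s - 1)"
    using ws assms by (auto simp: vs_def us_def)
  let ?L = "{vs. length vs = s - 1 \<and> distinct vs \<and> set vs \<subseteq> {1..n}}"
  let ?f = "\<lambda>vs. pmf (grs_extend n s E (k - (s - 1)) vs) (Some ws)"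
  have sub: "?L \<subseteq> {xs. set xs \<subseteq> {1..n} \<and> length xs = s - 1}" by auto
  have finL: "finite ?L" by (rule finite_subset[OF sub]) (simp add: finite_lists_length_eq)
  have cardL: "card ?L \<le> n ^ (s - 1)"
    using card_mono[OF _ sub] by (simp add: finite_lists_length_eq card_lists_length_eq)
  have "distinct vs" "set vs \<subseteq> {1..n}"
    using ws W by (auto simp: vs_def dest: in_set_takeD)
  \<comment> \<open>Besides being the wanted start, \<open>vs\<close> witnesses that starting tuples
    exist, so that \<open>pmf_of_set\<close> is meaningful here.\<close>
  hence vs: "vs \<in> ?L" using vu by simp
  hence cpos: "card ?L > 0" using finL by (auto simp: card_gt_0_iff)
  have low: "(\<Prod>i\<in>{s - 1..<k}. 1 / b i) \<le> ?f vs"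
    using grs_extend_pmf_lower[of s vs us "k - (s - 1)" n E b] assms vu ws W
    by simp
  have "1 / (real n ^ (s - 1) * (\<Prod>i\<in>{s - 1..<k}. b i)) = (\<Prod>i\<in>{s - 1..<k}. 1 / b i) / real n ^ (s - 1)"
    by (simp add: prod_dividef)
  also have "\<dots> \<le> ?f vs / real n ^ (s - 1)" using low by (intro divide_right_mono) auto
  also have "\<dots> \<le> ?f vs / real (card ?L)"
  proof (intro divide_left_mono mult_pos_pos)
    show "real (card ?L) \<le> real n ^ (s - 1)" using cardL by (metis of_nat_le_iff of_nat_power)
    thus "0 < real n ^ (s - 1)" using cpos by linarith
  qed (use cpos in auto)
  also have "\<dots> \<le> (\<Sum>vs\<in>?L. ?f vs) / real (card ?L)"
    using member_le_sum[OF vs _ finL, of ?f] by (intro divide_right_mono) auto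
  also have "\<dots> = pmf (grs_iteration n k s E) (Some ws)"
    unfolding grs_iteration_def using vs finL by (subst pmf_bind_pmf_of_set) auto
  finally show ?thesis using that ws by blast
qed

section \<open>Repeated iterations, soundness and the failure probability\<close>

text \<open>Condition on the set \<open>S\<close> collected so far: a clique already in
  \<open>S\<close> stays there, and any other is missed again with probability at most
  \<open>1 - q\<close>, since the next iteration is independent of \<open>S\<close>.\<close>

lemma grs_clique_missed_prob:
  assumes "q \<le> pmf (grs_iteration n k s E) (Some ws)"
  shows "measure_pmf.prob (greedy_random_sampling n k s E t) {S. set ws \<notin> S} \<le> (1 - q) ^ t"
proof (induction t)
  case 0
  show ?case by simp
next
  case (Suc t)
  let ?G = "greedy_random_sampling n k s E t" and ?I = "grs_iteration n k s E"
  let ?h = "\<lambda>S r. case r of None \<Rightarrow> S | Some vs \<Rightarrow> insert (set vs) S"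
  have q: "q \<le> 1" by (rule order_trans[OF assms pmf_le_1])
  have step: "measure_pmf.prob (map_pmf (?h S) ?I) {S. set ws \<notin> S}
                \<le> (1 - q) * indicator {S. set ws \<notin> S} S" for S
  proof (cases "set ws \<in> S")
    case True
    hence "?h S -` {S. set ws \<notin> S} = {}" by (auto split: option.splits)
    thus ?thesis using True by (simp add: measure_map_pmf)
  next
    case False
    have "measure_pmf.prob (map_pmf (?h S) ?I) {S. set ws \<notin> S} \<le> measure_pmf.prob ?I (- {Some ws})"
      unfolding measure_map_pmf by (intro measure_pmf.finite_measure_mono) auto
    also have "\<dots> = 1 - pmf ?I (Some ws)"
      using measure_pmf.prob_compl[of "{Some ws}" ?I] by (simp add: Compl_eq_Diff_UNIV measure_pmf_single)
    finally show ?thesis using assms False by simp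
  qed
  have "greedy_random_sampling n k s E (Suc t) = bind_pmf ?G (\<lambda>S. map_pmf (?h S) ?I)"
    by (simp add: map_pmf_def)
  hence "measure_pmf.prob (greedy_random_sampling n k s E (Suc t)) {S. set ws \<notin> S}
      = measure_pmf.expectation ?G (\<lambda>S. measure_pmf.prob (map_pmf (?h S) ?I) {S. set ws \<notin> S})"
    by (simp only: prob_bind_pmf)
  also have "\<dots> \<le> measure_pmf.expectation ?G (\<lambda>S. (1 - q) * indicator {S. set ws \<notin> S} S)"
    \<comment> \<open>The number \<open>q\<close> may be negative, which makes \<open>1 - q\<close>
      exceed 1; the maximum bounds both integrands in every case.\<close>
    by (intro integral_mono step measure_pmf.integrable_const_bound[where B = "max 1 (1 - q)"] AE_I2)
       (auto simp: indicator_def le_max_iff_disj q)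
  also have "\<dots> = (1 - q) * measure_pmf.prob ?G {S. set ws \<notin> S}" by simp
  also have "\<dots> \<le> (1 - q) * (1 - q) ^ t" using q by (intro mult_left_mono Suc.IH) auto
  finally show ?case by simp
qed

text \<open>Being a clique is invariant under extension: an \<open>s\<close>-subset of the enlarged
  set either avoids the new vertex \<open>v\<close> and is covered by the invariant, or is
  \<open>v\<close> together with an \<open>(s - 1)\<close>-subset of the old vertices, which is what
  \<open>common_nbrs\<close> tests.\<close>

lemma grs_extend_sound:
  assumes "s \<ge> 1" "Some ws \<in> set_pmf (grs_extend n s E m vs)"
    and "distinct vs" "set vs \<subseteq> {1..n}" "nsets (set vs) s \<subseteq> E"
  shows "length ws = length vs + m \<and> distinct ws \<and> set ws \<subseteq> {1..n} \<and> nsets (set ws) s \<subseteq> E"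
  using assms(2-)
proof (induction m arbitrary: vs)
  case 0
  then show ?case by simp
next
  case (Suc m)
  let ?C = "common_nbrs n s E (set vs)"
  from Suc.prems(1) obtain v where v: "v \<in> ?C" "Some ws \<in> set_pmf (grs_extend n s E m (vs @ [v]))"
    by (auto simp: Let_def set_pmf_of_set split: if_splits)
  have new: "v \<in> {1..n}" "v \<notin> set vs" using v(1) by (auto simp: common_nbrs_def)
  have "X \<in> E" if X: "X \<in> nsets (set (vs @ [v])) s" for X
  proof (cases "v \<in> X")
    case True
    hence "X - {v} \<in> nsets (set vs) (s - 1)" using X by (auto simp: nsets_def)
    hence "(X - {v}) \<union> {v} \<in> E" using v(1) unfolding common_nbrs_def by blast
    moreover have "(X - {v}) \<union> {v} = X" using True by blast
    ultimately show ?thesis by simp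
  next
    case False
    hence "X \<in> nsets (set vs) s" using X by (auto simp: nsets_def)
    thus ?thesis using Suc.prems by blast
  qed
  thus ?case using Suc.IH[OF v(2)] Suc.prems new by auto
qed

lemma grs_iteration_sound:
  assumes "1 \<le> s" "s \<le> k" "s - 1 \<le> n" "Some ws \<in> set_pmf (grs_iteration n k s E)"
  shows "set ws \<in> cliques n k s E"
proof -
  let ?L = "{vs. length vs = s - 1 \<and> distinct vs \<and> set vs \<subseteq> {1..n}}"
  have "?L \<subseteq> {xs. set xs \<subseteq> {1..n} \<and> length xs = s - 1}" by auto
  hence finL: "finite ?L" by (rule finite_subset) (simp add: finite_lists_length_eq)
  \<comment> \<open>This list has length \<open>s - 1\<close> and fits into \<open>{1..n}\<close> by
    \<open>s - 1 \<le> n\<close>; without any starting tuple the first draw would be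
    unspecified.\<close>
  have "[1..<s] \<in> ?L" using assms by auto
  hence "?L \<noteq> {}" by blast
  with finL obtain vs where vs: "vs \<in> ?L" "Some ws \<in> set_pmf (grs_extend n s E (k - (s - 1)) vs)"
    using assms(4) unfolding grs_iteration_def by (auto simp: set_pmf_of_set)
  \<comment> \<open>The invariant holds vacuously at the start: \<open>s - 1\<close> vertices have
    no \<open>s\<close>-subset.\<close>
  have "nsets (set vs) s = {}"
    using vs(1) assms(1) by (intro nsets_eq_empty) (auto simp: distinct_card)
  hence "length ws = k" "distinct ws" "set ws \<subseteq> {1..n}" "nsets (set ws) s \<subseteq> E"
    using grs_extend_sound[OF assms(1) vs(2)] vs(1) assms(1,2) by auto
  moreover from this have "set ws \<in> nsets {1..n} k"
    by (simp add: nsets_def distinct_card)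
  ultimately show ?thesis by (simp add: cliques_def)
qed

lemma greedy_random_sampling_sound:
  assumes "1 \<le> s" "s \<le> k" "s - 1 \<le> n" "S \<in> set_pmf (greedy_random_sampling n k s E t)"
  shows "S \<subseteq> cliques n k s E"
  using assms(4)
proof (induction t arbitrary: S)
  case 0
  then show ?case by simp
next
  case (Suc t)
  then show ?case
    by (auto split: option.splits dest: grs_iteration_sound[OF assms(1-3)])
qed

lemma card_nsets_le_power: "finite A \<Longrightarrow> card (nsets A i) \<le> card A ^ i"
  using binomial_fact_pow[of "card A" i] by (simp add: order_trans[OF _ binomial_fact_pow])

text \<open>By soundness a wrong output can only lack a clique. There are at most
  \<open>n ^ k\<close> cliques, and each is missed with probability at most
  \<open>(1 - q) ^ t \<le> exp (- q * t)\<close>.\<close>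

lemma greedy_random_sampling_failure:
  assumes "1 \<le> s" "s \<le> k" "s - 1 \<le> n"
    and b: "\<And>i A. \<lbrakk>s - 1 \<le> i; i < k; A \<in> nsets {1..n} i\<rbrakk>
           \<Longrightarrow> real (card (common_nbrs n s E A)) \<le> b i"
    and b_pos: "\<And>i. \<lbrakk>s - 1 \<le> i; i < k\<rbrakk> \<Longrightarrow> b i > 0"
  shows "measure_pmf.prob (greedy_random_sampling n k s E t) {S. S \<noteq> cliques n k s E}
           \<le> real n ^ k * exp (- real t / (real n ^ (s - 1) * (\<Prod>i\<in>{s - 1..<k}. b i)))"
proof -
  let ?P = "measure_pmf.prob (greedy_random_sampling n k s E t)"
  let ?K = "cliques n k s E"
  define q where "q = 1 / (real n ^ (s - 1) * (\<Prod>i\<in>{s - 1..<k}. b i))"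
  have K: "?K \<subseteq> nsets {1..n} k" by (auto simp: cliques_def)
  hence finK: "finite ?K" by (rule finite_subset) (simp add: finite_imp_finite_nsets)
  have "card ?K \<le> n ^ k"
    using card_mono[OF _ K] card_nsets_le_power[of "{1..n}" k]
    by (simp add: finite_imp_finite_nsets)
  hence cardK: "real (card ?K) \<le> real n ^ k" by (metis of_nat_le_iff of_nat_power)
  have miss: "?P {S. W \<notin> S} \<le> exp (- q * real t)" if W: "W \<in> ?K" for W
  proof -
    obtain ws where ws: "set ws = W" "q \<le> pmf (grs_iteration n k s E) (Some ws)"
      unfolding q_def by (rule grs_iteration_pmf_lower[where b = b, OF assms(1,2) W b])
    have "q \<le> 1" by (rule order_trans[OF ws(2) pmf_le_1])
    have "?P {S. W \<notin> S} \<le> (1 - q) ^ t" using grs_clique_missed_prob[OF ws(2)] ws(1) by simp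
    also have "\<dots> \<le> exp (- q) ^ t"
      using \<open>q \<le> 1\<close> exp_ge_add_one_self[of "- q"] by (intro power_mono) auto
    finally show ?thesis by (simp add: mult.commute flip: exp_of_nat_mult)
  qed
  have "?P {S. S \<noteq> ?K} \<le> ?P (\<Union>W\<in>?K. {S. W \<notin> S})"
    using greedy_random_sampling_sound[OF assms(1-3)]
    by (intro measure_pmf.finite_measure_mono_AE) (auto simp: AE_measure_pmf_iff)
  also have "\<dots> \<le> (\<Sum>W\<in>?K. ?P {S. W \<notin> S})"
    by (intro measure_pmf.finite_measure_subadditive_finite finK) auto
  also have "\<dots> \<le> (\<Sum>W\<in>?K. exp (- q * real t))" by (intro sum_mono miss)
  also have "\<dots> = real (card ?K) * exp (- q * real t)" by simp
  also have "\<dots> \<le> real n ^ k * exp (- q * real t)" by (intro mult_right_mono cardK) auto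
  finally show ?thesis by (simp add: q_def)
qed

text \<open>The failure probability is split according to the hypergraph: the first sum bounds the
  probability that some set has too many common neighbours, the second term the failure of the
  sampling on every other hypergraph.\<close>

lemma grs_experiment_failure:
  assumes "0 \<le> c" "c \<le> 1" "1 \<le> s" "s \<le> k" "s - 1 \<le> n" "D \<ge> 0"
    and b_pos: "\<And>i. \<lbrakk>s - 1 \<le> i; i < k\<rbrakk> \<Longrightarrow> b i > 0"
    and b: "\<And>i. \<lbrakk>s - 1 \<le> i; i < k\<rbrakk> \<Longrightarrow> exp (D + 1) * real n * c ^ (i choose (s - 1)) \<le> b i"
  shows "1 - measure_pmf.prob (grs_experiment n c s k t) {(E, S). S = cliques n k s E}
           \<le> (\<Sum>i\<in>{s - 1..<k}. real n ^ i * exp (- D * b i))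
             + real n ^ k * exp (- real t / (real n ^ (s - 1) * (\<Prod>i\<in>{s - 1..<k}. b i)))"
proof -
  let ?H = "random_hgraph n c s" and ?G = "\<lambda>E. greedy_random_sampling n k s E t"
  define x where "x = real n ^ k * exp (- real t / (real n ^ (s - 1) * (\<Prod>i\<in>{s - 1..<k}. b i)))"
  define bad where "bad = (\<lambda>i A. {E. b i \<le> real (card (common_nbrs n s E A))})"
  define Bad where "Bad = (\<Union>i\<in>{s - 1..<k}. \<Union>A\<in>nsets {1..n} i. bad i A)"
  have x: "x \<ge> 0" by (simp add: x_def)
  have "measure_pmf.prob ?H Bad \<le> (\<Sum>i\<in>{s - 1..<k}. measure_pmf.prob ?H (\<Union>A\<in>nsets {1..n} i. bad i A))"
    unfolding Bad_def by (intro measure_pmf.finite_measure_subadditive_finite) auto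
  also have "\<dots> \<le> (\<Sum>i\<in>{s - 1..<k}. \<Sum>A\<in>nsets {1..n} i. measure_pmf.prob ?H (bad i A))"
    by (intro sum_mono measure_pmf.finite_measure_subadditive_finite finite_imp_finite_nsets) auto
  also have "\<dots> \<le> (\<Sum>i\<in>{s - 1..<k}. \<Sum>A\<in>nsets {1..n} i. exp (- D * b i))"
    unfolding bad_def using assms by (intro sum_mono card_common_nbrs_tail) auto
  also have "\<dots> \<le> (\<Sum>i\<in>{s - 1..<k}. real n ^ i * exp (- D * b i))"
  proof (rule sum_mono)
    fix i
    have "real (card (nsets {1..n} i)) \<le> real n ^ i"
      using card_nsets_le_power[of "{1..n}" i] by (metis card_atLeastAtMost diff_Suc_1 finite_atLeastAtMost of_nat_le_iff of_nat_power)
    thus "(\<Sum>A\<in>nsets {1..n} i. exp (- D * b i)) \<le> real n ^ i * exp (- D * b i)"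
      unfolding sum_constant by (intro mult_right_mono) auto
  qed
  finally have Bad: "measure_pmf.prob ?H Bad \<le> (\<Sum>i\<in>{s - 1..<k}. real n ^ i * exp (- D * b i))" .
  \<comment> \<open>On \<open>Bad\<close> the trivial bound 1 is enough.\<close>
  have cond: "measure_pmf.prob (?G E) {S. S \<noteq> cliques n k s E} \<le> indicator Bad E + x" for E
  proof (cases "E \<in> Bad")
    case True
    thus ?thesis using x by (simp add: add_increasing2)
  next
    case False
    hence "real (card (common_nbrs n s E A)) \<le> b i" if "s - 1 \<le> i" "i < k" "A \<in> nsets {1..n} i" for i A
      using that unfolding Bad_def bad_def by force
    thus ?thesis unfolding x_def
      using greedy_random_sampling_failure[of s k n E b t] assms False by simp
  qed
  have exper: "grs_experiment n c s k t = bind_pmf ?H (\<lambda>E. map_pmf (Pair E) (?G E))"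
    by (simp add: grs_experiment_def map_pmf_def)
  have "1 - measure_pmf.prob (grs_experiment n c s k t) {(E, S). S = cliques n k s E}
      = measure_pmf.prob (grs_experiment n c s k t) (- {(E, S). S = cliques n k s E})"
    using measure_pmf.prob_compl[of "{(E, S). S = cliques n k s E}" "grs_experiment n c s k t"]
    by (simp add: Compl_eq_Diff_UNIV)
  also have "\<dots> = measure_pmf.expectation ?H (\<lambda>E. measure_pmf.prob (?G E) {S. S \<noteq> cliques n k s E})"
    unfolding exper prob_bind_pmf measure_map_pmf
    by (intro Bochner_Integration.integral_cong arg_cong2[where f = measure]) auto
  also have "\<dots> \<le> measure_pmf.expectation ?H (\<lambda>E. indicator Bad E + x)"
    by (intro integral_mono cond measure_pmf.integrable_const_bound[where B = "1 + x"] AE_I2)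
       (use x in \<open>auto simp: indicator_def intro: order_trans[OF measure_pmf.prob_le_1]\<close>)
  also have "\<dots> = measure_pmf.prob ?H Bad + x"
    by (subst Bochner_Integration.integral_add)
       (auto intro!: measure_pmf.integrable_const_bound[where B = 1])
  finally show ?thesis using Bad by (simp add: x_def)
qed

section \<open>The product of the bounds and asymptotic estimates\<close>

text \<open>The exponents of \<open>c\<close> add up by the hockey-stick identity, here obtained
  from Pascal's rule. This produces the exponent \<open>r choose s\<close> that occurs in the
  hypothesis on \<open>T\<close>.\<close>

lemma prod_power_binomial:
  fixes a c :: "'a::comm_semiring_1"
  assumes "1 \<le> s" "s - 1 \<le> r"
  shows "(\<Prod>i\<in>{s - 1..<r}. a * c ^ (i choose (s - 1))) = a ^ (r - (s - 1)) * c ^ (r choose s)"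
  using assms(2)
proof (induction r rule: dec_induct)
  case base
  show ?case using assms(1) by (simp add: binomial_eq_0)
next
  case (step r)
  have "Suc r choose s = (r choose (s - 1)) + (r choose s)"
    using assms(1) by (cases s) auto
  thus ?case using step by (simp add: Suc_diff_le power_add mult_ac)
qed

text \<open>The spare power of \<open>1 / n\<close> turns big-O into little-o. The constant may
  depend on \<open>d\<close>, so the proof of the bound may be set up anew for each
  \<open>d\<close>.\<close>

lemma superpoly_smallI:
  assumes "\<And>n. 0 \<le> f n"
    and "\<And>d. \<exists>C. \<forall>\<^sub>F n in sequentially. f n \<le> C / real n ^ Suc d"
  shows "superpoly_small f"
  unfolding superpoly_small_def
proof
  fix d
  obtain C where C: "\<forall>\<^sub>F n in sequentially. f n \<le> C / real n ^ Suc d" using assms(2) by blast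
  have "f \<in> O(\<lambda>n. 1 / real n ^ Suc d)"
    by (rule bigoI[of _ C]) (use C assms(1) in \<open>auto elim!: eventually_mono\<close>)
  also have "(\<lambda>n. 1 / real n ^ Suc d) \<in> o(\<lambda>n. (1 / real n) ^ d)"
  proof (rule smalloI_tendsto)
    have "\<forall>\<^sub>F n in sequentially. 1 / real n = 1 / real n ^ Suc d / (1 / real n) ^ d"
      using eventually_gt_at_top[of 0] by eventually_elim (simp add: power_divide)
    moreover have "(\<lambda>n. 1 / real n) \<longlonglongrightarrow> 0" by real_asymp
    ultimately show "(\<lambda>n. 1 / real n ^ Suc d / (1 / real n) ^ d) \<longlonglongrightarrow> 0"
      by (rule Lim_transform_eventually[rotated])
    show "\<forall>\<^sub>F n in sequentially. (1 / real n) ^ d \<noteq> 0"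
      using eventually_gt_at_top[of 0] by eventually_elim simp
  qed
  finally show "f \<in> o(\<lambda>n. (1 / real n) ^ d)" .
qed

text \<open>The mean is at least a constant times \<open>n powr (1 - \<alpha> * j)\<close>, a
  positive power of \<open>n\<close>.\<close>

lemma eventually_const_mult_power_ge_ln:
  assumes "c \<in> \<Omega>(\<lambda>n. real n powr (- \<alpha>))" "\<And>n. 0 \<le> c n" "\<alpha> * real j < 1" "G > 0"
  shows "\<forall>\<^sub>F n in sequentially. ln (real n) \<le> G * real n * c n ^ j"
proof -
  obtain L where L: "L > 0" "\<forall>\<^sub>F n in sequentially. norm (c n) \<ge> L * norm (real n powr (- \<alpha>))"
    using assms(1) by (elim landau_omega.bigE)
  define e where "e = 1 - \<alpha> * real j"
  have e: "e > 0" using assms(3) by (simp add: e_def)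
  define H where "H = G * L ^ j"
  have H: "H > 0" using assms(4) L by (simp add: H_def)
  have "\<forall>\<^sub>F n in sequentially. ln (real n) \<le> H * real n powr e"
    using e H by real_asymp
  thus ?thesis using L(2) eventually_gt_at_top[of 0]
  proof eventually_elim
    case (elim n)
    have "(L * real n powr (- \<alpha>)) ^ j \<le> c n ^ j"
      using elim L assms(2)[of n] by (intro power_mono) auto
    hence "G * real n * (L * real n powr (- \<alpha>)) ^ j \<le> G * real n * c n ^ j"
      using assms(4) by (intro mult_left_mono) auto
    moreover have "(real n powr (- \<alpha>)) ^ j = real n powr (- \<alpha> * real j)"
      using elim by (simp add: powr_power mult.commute)
    hence "G * real n * (L * real n powr (- \<alpha>)) ^ j = H * (real n powr 1 * real n powr (- \<alpha> * real j))"
      using elim by (simp add: power_mult_distrib H_def)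
    also have "\<dots> = H * real n powr e" 
      using powr_add[of "real n" 1 "- \<alpha> * real j"] by (simp add: e_def)
    ultimately show ?case using elim(1) H by auto
  qed
qed

text \<open>The exponent \<open>1 - \<alpha> * j\<close> is now at most 0. In the boundary case it
  vanishes and the mean is only bounded, which the growing logarithm still dominates.\<close>

lemma eventually_const_mult_power_le_ln:
  assumes "c \<in> O(\<lambda>n. real n powr (- \<alpha>))" "\<And>n. 0 \<le> c n" "\<alpha> * real j \<ge> 1" "G > 0"
  shows "\<forall>\<^sub>F n in sequentially. G * real n * c n ^ j \<le> ln (real n)"
proof -
  obtain U where U: "U > 0" "\<forall>\<^sub>F n in sequentially. norm (c n) \<le> U * norm (real n powr (- \<alpha>))"
    using assms(1) by (elim landau_o.bigE)
  define H where "H = G * U ^ j"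
  have H: "H > 0" using assms(4) U by (simp add: H_def)
  have "\<forall>\<^sub>F n in sequentially. H \<le> ln (real n)" by real_asymp
  thus ?thesis using U(2) eventually_gt_at_top[of 0]
  proof eventually_elim
    case (elim n)
    have "c n ^ j \<le> (U * real n powr (- \<alpha>)) ^ j"
      using elim U assms(2)[of n] by (intro power_mono) auto
    hence "G * real n * c n ^ j \<le> G * real n * (U * real n powr (- \<alpha>)) ^ j"
      using assms(4) by (intro mult_left_mono) auto
    also have "(real n powr (- \<alpha>)) ^ j = real n powr (- \<alpha> * real j)"
      using elim by (simp add: powr_power mult.commute)
    hence "G * real n * (U * real n powr (- \<alpha>)) ^ j = H * (real n powr 1 * real n powr (- \<alpha> * real j))"
      using elim by (simp add: power_mult_distrib H_def)
    also have "\<dots> = H * real n powr (1 - \<alpha> * real j)" 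
      using powr_add[of "real n" 1 "- \<alpha> * real j"] by simp
    also have "\<dots> \<le> H * real n powr 0"
      using elim assms(3) H by (intro mult_left_mono powr_mono) auto
    finally show ?case using elim H by simp
  qed
qed

text \<open>Write the power of the logarithm as \<open>ln n powr \<epsilon> * ln n\<close>; the
  first factor eventually exceeds \<open>m / K\<close>. This is where \<epsilon> > 0 yields
  superpolynomial decay.\<close>

lemma eventually_exp_minus_ln_powr_le:
  assumes "K > 0" "\<epsilon> > 0"
  shows "\<forall>\<^sub>F n in sequentially. exp (- K * ln (real n) powr (1 + \<epsilon>)) \<le> 1 / real n ^ m"
proof -
  define M where "M = real m"
  have "\<forall>\<^sub>F n in sequentially. M \<le> K * ln (real n) powr \<epsilon>"
    using assms by real_asymp
  thus ?thesis using eventually_gt_at_top[of 1]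
  proof eventually_elim
    case (elim n)
    have "M * ln (real n) \<le> K * ln (real n) powr \<epsilon> * ln (real n)"
      using elim by (intro mult_right_mono) auto
    also have "\<dots> = K * ln (real n) powr (1 + \<epsilon>)"
      using elim by (simp add: powr_add)
    finally have "exp (- K * ln (real n) powr (1 + \<epsilon>)) \<le> exp (- (M * ln (real n)))" by simp
    also have "\<dots> = 1 / real n ^ m"
      using elim by (simp add: M_def exp_minus exp_of_nat_mult field_simps)
    finally show ?case .
  qed
qed

section \<open>Choice of the bounds for each \<open>d\<close> and comparison with
  \<open>T\<close>\<close>

theorem theorem5p2:
  fixes k s \<tau> :: nat and \<alpha> \<epsilon> :: real and c :: "nat \<Rightarrow> real" and T :: "nat \<Rightarrow> nat"
  assumes "2 \<le> s" and "s \<le> k"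
    and "0 < \<alpha>" and "\<alpha> < 1"
    and "\<And>n. 0 \<le> c n \<and> c n \<le> 1"
    and "c \<in> \<Theta>(\<lambda>n. real n powr (- \<alpha>))"
    and "\<alpha> * real (\<tau> choose (s - 1)) < 1"
    and "\<And>t. \<alpha> * real (t choose (s - 1)) < 1 \<Longrightarrow> t \<le> \<tau>"
    and "0 < \<epsilon>"
    and "\<forall>\<^sub>F n in sequentially.
           real (T n) \<ge>
             (if k \<ge> \<tau> + 1
              then 2 * real n ^ (\<tau> + 1) * c n ^ ((\<tau> + 1) choose s)
                     * (3 * ln (real n)) powr ((real k - real \<tau>) * (1 + \<epsilon>))
              else 2 * real n ^ k * c n ^ (k choose s) * ln (real n) powr (1 + \<epsilon>))"
  shows "superpoly_small (\<lambda>n. 1 - measure_pmf.prob (grs_experiment n (c n) s k (T n))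
                               {(E, S). S = cliques n k s E})"
proof -
  have \<alpha>: "\<alpha> * real (i choose (s - 1)) < 1" if "i \<le> \<tau>" for i
  proof -
    have "real (i choose (s - 1)) \<le> real (\<tau> choose (s - 1))"
      using that by (simp add: binomial_right_mono)
    hence "\<alpha> * real (i choose (s - 1)) \<le> \<alpha> * real (\<tau> choose (s - 1))"
      using assms(3) by (intro mult_left_mono) auto
    thus ?thesis using assms(7) by simp
  qed
  \<comment> \<open>The binomial coefficient at \<open>s - 1\<close> is 1, so \<alpha> < 1 makes
    \<open>s - 1\<close> admissible in the maximality of \<tau>.\<close>
  have s\<tau>: "s - 1 \<le> \<tau>" using assms(4) assms(8)[of "s - 1"] by simp
  \<comment> \<open>Sets of size \<open>i < r\<close> get the polynomial bound, those with
    \<open>r \<le> i < k\<close> the logarithmic one. This merges the two cases of the hypothesis on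
    \<open>T\<close>.\<close>
  define r where "r = min k (\<tau> + 1)"
  have r: "s - 1 \<le> r" "r \<le> k" using s\<tau> assms(2) by (auto simp: r_def)
  \<comment> \<open>The logarithmic factor is split into \<open>k - r\<close> factors that match the
    bounds \<open>3 * ln n\<close> and one that drives the decay. For
    \<open>k \<ge> \<tau> + 1\<close> this uses \<open>(k - \<tau> - 1) + (1 + \<epsilon>) \<le> (k
    - \<tau>) * (1 + \<epsilon>)\<close>.\<close>
  have T: "\<forall>\<^sub>F n in sequentially. real (T n) \<ge>
      2 * real n ^ r * c n ^ (r choose s) * ((3 * ln (real n)) ^ (k - r) * ln (real n) powr (1 + \<epsilon>))"
  proof (cases "k \<ge> \<tau> + 1")
    case False
    with assms(10) show ?thesis by (simp add: r_def mult.assoc)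
  next
    case True
    have ge: "\<forall>\<^sub>F n in sequentially. 1 \<le> 3 * ln (real n)" by real_asymp
    show ?thesis using assms(10) ge
    proof eventually_elim
      case (elim n)
      let ?l = "3 * ln (real n)"
      have "?l ^ (k - r) * ln (real n) powr (1 + \<epsilon>) \<le> ?l ^ (k - r) * ?l powr (1 + \<epsilon>)"
        using elim assms(9) by (intro mult_left_mono powr_mono2) auto
      also have "\<dots> = ?l powr (real (k - r) + (1 + \<epsilon>))"
        using elim by (subst powr_add) (simp add: powr_realpow)
      also have "\<dots> \<le> ?l powr ((real k - real \<tau>) * (1 + \<epsilon>))"
      proof (rule powr_mono)
        have "real (k - r) = real k - real \<tau> - 1" using True by (simp add: r_def)
        moreover have "1 * \<epsilon> \<le> (real k - real \<tau>) * \<epsilon>"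
          using True assms(9) by (intro mult_right_mono) auto
        ultimately show "real (k - r) + (1 + \<epsilon>) \<le> (real k - real \<tau>) * (1 + \<epsilon>)"
          by (simp add: algebra_simps)
      qed (use elim in auto)
      finally have "2 * real n ^ r * c n ^ (r choose s) * (?l ^ (k - r) * ln (real n) powr (1 + \<epsilon>))
          \<le> 2 * real n ^ r * c n ^ (r choose s) * ?l powr ((real k - real \<tau>) * (1 + \<epsilon>))"
        using assms(5)[of n] by (intro mult_left_mono) auto
      moreover have "r = \<tau> + 1" using True by (simp add: r_def)
      ultimately show ?case using elim(1) True by simp
    qed
  qed
  show ?thesis
  proof (rule superpoly_smallI)
    show "0 \<le> 1 - measure_pmf.prob (grs_experiment n (c n) s k (T n)) {(E, S). S = cliques n k s E}" for n
      by simp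
  next
    fix d
    \<comment> \<open>Since \<open>b i \<ge> ln n\<close>, this \<open>D\<close> makes each tail \<open>exp (- D * b i)\<close> at most \<open>1 / n^(k + d)\<close>, which
      pays for the \<open>n^i\<close> sets \<open>A\<close>; it only affects the constant \<open>K\<close> below.\<close>
    define D where "D = real (k + d)"
    define G where "G = exp (D + 1)"
    \<comment> \<open>The 2 comes from the hypothesis on \<open>T\<close>, the power of
      \<open>G\<close> from the \<open>r - (s - 1)\<close> polynomial bounds; any positive constant
      would do.\<close>
    define K where "K = 2 / G ^ (r - (s - 1))"
    define b where "b = (\<lambda>n i. if i \<le> \<tau> then G * real n * c n ^ (i choose (s - 1)) else 3 * ln (real n))"
    have G: "G > 0" and K: "K > 0" by (auto simp: G_def K_def)
    have ln1: "\<forall>\<^sub>F n in sequentially. 1 \<le> ln (real n)" by real_asymp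
    have low: "\<forall>\<^sub>F n in sequentially. \<forall>i\<in>{s - 1..<k}. ln (real n) \<le> b n i"
    proof (intro eventually_ball_finite ballI finite_atLeastLessThan)
      fix i
      show "\<forall>\<^sub>F n in sequentially. ln (real n) \<le> b n i"
      proof (cases "i \<le> \<tau>")
        case True
        with \<alpha> assms(5) G bigthetaD2[OF assms(6)] show ?thesis
          by (auto simp: b_def intro!: eventually_const_mult_power_ge_ln)
      next
        case False
        with ln1 show ?thesis by (auto simp: b_def elim!: eventually_mono)
      qed
    qed
    have high: "\<forall>\<^sub>F n in sequentially. \<forall>i\<in>{s - 1..<k}. G * real n * c n ^ (i choose (s - 1)) \<le> b n i"
    proof (intro eventually_ball_finite ballI finite_atLeastLessThan)
      fix i
      show "\<forall>\<^sub>F n in sequentially. G * real n * c n ^ (i choose (s - 1)) \<le> b n i"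
      proof (cases "i \<le> \<tau>")
        case True
        thus ?thesis by (simp add: b_def)
      next
        case False
        \<comment> \<open>Maximality of \<tau>, in contrapositive form.\<close>
        hence "\<alpha> * real (i choose (s - 1)) \<ge> 1" using assms(8)[of i] by linarith
        hence "\<forall>\<^sub>F n in sequentially. G * real n * c n ^ (i choose (s - 1)) \<le> ln (real n)"
          using assms(5) G bigthetaD1[OF assms(6)] by (intro eventually_const_mult_power_le_ln) auto
        with ln1 show ?thesis
          by eventually_elim (use False in \<open>auto simp: b_def\<close>)
      qed
    qed
    have cpos: "\<forall>\<^sub>F n in sequentially. ln (real n) \<le> 1 * real n * c n ^ 1"
      using assms(4,5) bigthetaD2[OF assms(6)] by (intro eventually_const_mult_power_ge_ln) auto
    have "\<forall>\<^sub>F n in sequentially.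
        1 - measure_pmf.prob (grs_experiment n (c n) s k (T n)) {(E, S). S = cliques n k s E}
          \<le> real (Suc k) / real n ^ Suc d"
      using ln1 low high cpos T eventually_ge_at_top[of "max 1 (s - 1)"]
        eventually_exp_minus_ln_powr_le[OF K assms(9), of "k + Suc d"]
    proof eventually_elim
      case (elim n)
      let ?p = "1 / real n ^ Suc d"
      have n: "n \<ge> 1" "s - 1 \<le> n" using elim(6) by auto
      have c: "c n > 0" using elim(1,4) n assms(5)[of n] by (cases "c n = 0") auto
      have bpos: "b n i > 0" if "s - 1 \<le> i" "i < k" for i
        using elim(1,2) that by force
      have first: "real n ^ i * exp (- D * b n i) \<le> ?p" if "i \<in> {s - 1..<k}" for i
      proof -
        have "D * ln (real n) \<le> D * b n i" using elim(2) that by (intro mult_left_mono) (auto simp: D_def)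
        hence "exp (- D * b n i) \<le> exp (- (D * ln (real n)))" by simp
        also have "\<dots> = 1 / real n ^ (k + d)"
          unfolding D_def using n by (simp only: exp_minus exp_of_nat_mult exp_ln inverse_eq_divide)
        \<comment> \<open>Since \<open>i < k\<close>, at most \<open>k - 1\<close> powers of
          \<open>n\<close> are spent, which leaves \<open>Suc d\<close> of the
          \<open>k + d\<close>.\<close>
        finally have "real n ^ i * exp (- D * b n i) \<le> real n ^ (k - 1) * (1 / real n ^ (k + d))"
          using that n by (intro mult_mono power_increasing) auto
        also have "\<dots> = ?p"
        proof -
          have "k + d = (k - 1) + Suc d" using that by auto
          thus ?thesis using n by (simp only: power_add) simp
        qed
        finally show ?thesis .
      qed
      \<comment> \<open>The \<open>s - 1\<close> powers of \<open>n\<close> from the starting tuple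
        complete the \<open>r - (s - 1)\<close> from the bounds to \<open>n ^ r\<close>, so the
        product has the shape of the bound on \<open>T\<close>.\<close>
      have prod: "real n ^ (s - 1) * (\<Prod>i\<in>{s - 1..<k}. b n i)
          = G ^ (r - (s - 1)) * real n ^ r * c n ^ (r choose s) * (3 * ln (real n)) ^ (k - r)"
      proof -
        have "(\<Prod>i\<in>{s - 1..<k}. b n i) = (\<Prod>i\<in>{s - 1..<r}. b n i) * (\<Prod>i\<in>{r..<k}. b n i)"
          using r by (simp add: prod.atLeastLessThan_concat)
        also have "(\<Prod>i\<in>{s - 1..<r}. b n i) = (\<Prod>i\<in>{s - 1..<r}. G * real n * c n ^ (i choose (s - 1)))"
          by (intro prod.cong) (auto simp: b_def r_def)
        also have "\<dots> = (G * real n) ^ (r - (s - 1)) * c n ^ (r choose s)"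
          using assms(1) r by (intro prod_power_binomial) auto
        also have "(\<Prod>i\<in>{r..<k}. b n i) = (\<Prod>i\<in>{r..<k}. 3 * ln (real n))"
          by (intro prod.cong) (auto simp: b_def r_def)
        also have "\<dots> = (3 * ln (real n)) ^ (k - r)" by simp
        moreover have "real n ^ r = real n ^ (s - 1) * real n ^ (r - (s - 1))"
          using r by (simp flip: power_add)
        ultimately show ?thesis by (simp add: power_mult_distrib mult_ac)
      qed
      have "K * ln (real n) powr (1 + \<epsilon>) * (real n ^ (s - 1) * (\<Prod>i\<in>{s - 1..<k}. b n i)) \<le> real (T n)"
        unfolding prod using elim(5) G by (simp add: K_def mult_ac)
      moreover have "real n ^ (s - 1) * (\<Prod>i\<in>{s - 1..<k}. b n i) > 0"
        using n bpos by (intro mult_pos_pos prod_pos) auto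
      ultimately have "K * ln (real n) powr (1 + \<epsilon>)
          \<le> real (T n) / (real n ^ (s - 1) * (\<Prod>i\<in>{s - 1..<k}. b n i))"
        by (simp add: pos_le_divide_eq)
      hence "exp (- real (T n) / (real n ^ (s - 1) * (\<Prod>i\<in>{s - 1..<k}. b n i)))
          \<le> exp (- K * ln (real n) powr (1 + \<epsilon>))" by simp
      also have "\<dots> \<le> 1 / real n ^ (k + Suc d)" by (fact elim(7))
      finally have "real n ^ k * exp (- real (T n) / (real n ^ (s - 1) * (\<Prod>i\<in>{s - 1..<k}. b n i)))
          \<le> real n ^ k * (1 / real n ^ (k + Suc d))" by (intro mult_left_mono) auto
      also have "\<dots> = ?p" using n by (simp add: power_add)
      finally have second: "real n ^ k * exp (- real (T n) / (real n ^ (s - 1) * (\<Prod>i\<in>{s - 1..<k}. b n i)))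
          \<le> ?p" .
      have "1 - measure_pmf.prob (grs_experiment n (c n) s k (T n)) {(E, S). S = cliques n k s E}
          \<le> (\<Sum>i\<in>{s - 1..<k}. real n ^ i * exp (- D * b n i))
             + real n ^ k * exp (- real (T n) / (real n ^ (s - 1) * (\<Prod>i\<in>{s - 1..<k}. b n i)))"
        using assms(1,2,5) n bpos elim(3)
        by (intro grs_experiment_failure) (auto simp: D_def G_def)
      also have "\<dots> \<le> (\<Sum>i\<in>{s - 1..<k}. ?p) + ?p" by (intro add_mono sum_mono first second)
      \<comment> \<open>There are \<open>k - (s - 1)\<close> tail terms and one sampling term, hence
        at most \<open>Suc k\<close>.\<close>
      also have "\<dots> \<le> real (Suc k) / real n ^ Suc d"
        by (simp add: divide_right_mono flip: add_divide_distrib)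
      finally show ?case .
    qed
    thus "\<exists>C. \<forall>\<^sub>F n in sequentially.
        1 - measure_pmf.prob (grs_experiment n (c n) s k (T n)) {(E, S). S = cliques n k s E}
          \<le> C / real n ^ Suc d" by blast
  qed
qed

end
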